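(* The system of partial differential equations (S) has at least one $\mathbb R$-differentiable $(n-k_1,n-k_2)$-cylindricality partial integral $f\colon z\mapsto f({}^kz)$ on $G'$ (of the form described in the context) if and only if there exist a vector function ${}^\lambda\varphi=({}^{k_1}\varphi({}^kz),{}^{k_2}\varphi({}^kz))$ with values in $\mathbb C^\lambda$ and functions $H_j$, $j=1,\dots,m$, satisfying the functional system (E) and such that (i) the Pfaffian differential equation (P) has an integrating factor; (ii) the function $f\colon z\mapsto f({}^kz)$ is a general integral of the Pfaffian equation (P).
   Context: Setting. $G\subset\mathbb C^n$ is a domain and $G'\subset G$ a subdomain. $\mathbb R$-differentiable means differentiable as a function of the real and imaginary parts of the variables (all higher derivatives that appear are assumed to exist); $\partial_{z_\xi},\partial_{\overline z_\xi}$ are Wirtinger derivatives. System (S) is the linear homogeneous system $$\mathfrak A_j(z)u=0,\ j=1,\dots,m,\qquad \mathfrak A_j(z)=\sum_{\xi=1}^n\bigl(u_{j\xi}(z)\partial_{z_\xi}+u_{j,n+\xi}(z)\partial_{\overline z_\xi}\bigr),\tag{S}$$ with $\mathbb R$-differentiable $u_{jp}\colon G\to\mathbb C$; the operators $\mathfrak A_1,\dots,\mathfrak A_m$ are not linearly bound on $G$ (operators are linearly bound on a domain if they are linearly dependent at every point of it). A (non-constant) $\mathbb R$-differentiable function $f\colon G'\to\mathbb C$ is a partial integral of (S) if $\mathfrak A_jf(z)=\Phi_j(f;z)$ on $G'$ with $\Phi_j(0;z)\equiv0$, $j=1,\dots,m$. A notation such as $\Phi(f;z)$ means a function depending on the value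 $f$ and on $z$; $\Phi(0;z)\equiv0$ means that it vanishes wherever $f=0$. Form of the functions. Fix $0\le k_1,k_2\le n$ and a permutation $(\zeta_1,\dots,\zeta_n)$ of $(1,\dots,n)$. An $(n-k_1,n-k_2)$-cylindricality function $f({}^kz)$ is an $\mathbb R$-differentiable function on $G'$ that is antiholomorphic in $z_{k_1+1},\dots,z_n$ and holomorphic in $z_{\zeta_{k_2+1}},\dots,z_{\zeta_n}$, i.e. $\partial_{z_\gamma}f=0$ for $\gamma>k_1$ and $\partial_{\overline z_{\zeta_\delta}}f=0$ for $\delta>k_2$. Notation. $\lambda=k_1+k_2$, ${}^\lambda u^j=(u_{j1},\dots,u_{jk_1},u_{j,n+\zeta_1},\dots,u_{j,n+\zeta_{k_2}})$. The unknowns are ${}^{k_1}\varphi=(\varphi^{(1)}_1,\dots,\varphi^{(1)}_{k_1})$, ${}^{k_2}\varphi=(\varphi^{(2)}_1,\dots,\varphi^{(2)}_{k_2})$ with components of the form $\cdot({}^kz)$, ${}^\lambda\varphi=({}^{k_1}\varphi,{}^{k_2}\varphi)$, and $\mathbb R$-differentiable $H_j=H_j(f;z)$ with $H_j(0;z)\equiv0$. With $a\cdot b=\sum a_ib_i$, system (E) on $G'$ is, for $j=1,\dots,m$, ${}^\lambda\varphi\cdot{}^\lambda u^j=H_j$; ${}^\lambda\varphi\cdot\partial_{z_\gamma}^l\,{}^\lambda u^j=\partial_{z_\gamma}^lH_j$, $l=1,\dots,\lambda-1$, $\gamma=k_1+1,\dots,n$; ${}^\lambda\varphi\cdot\partial_{\overline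 z_{\zeta_\delta}}^l\,{}^\lambda u^j=\partial_{\overline z_{\zeta_\delta}}^lH_j$, $l=1,\dots,\lambda-1$, $\delta=k_2+1,\dots,n$. The Pfaffian equation is $$\omega:=\sum_{\xi=1}^{k_1}\varphi^{(1)}_\xi dz_\xi+\sum_{\tau=1}^{k_2}\varphi^{(2)}_\tau d\overline z_{\zeta_\tau}=0.\tag{P}$$ An integrating factor of (P) is a non-vanishing function $\mu({}^kz)$ such that $\mu\,\omega=df$ for some function $f({}^kz)$; such a (non-constant) $f$ is a general integral of (P).
   Formalization: The partial integral f is also required to have ℝ-differentiable first derivatives; without this f = x|x| + iy with operator x∂_x + 2y∂_y (n = k_1 = k_2 = 1) is a partial integral that is no general integral of (P) with ℝ-differentiable φ and μ. *)

theory Defs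
  imports "HOL-Analysis.Analysis" "HOL-Combinatorics.Permutations"
begin

text \<open>
  Functions on subsets of complex n-space are total functions on \<open>complex^'n\<close>; only their
  values on the (open) domains in question matter.  R-differentiability is
  \<^const>\<open>differentiable_on\<close>, since \<open>complex^'n\<close> is a real normed vector space.
  The argument \<open>e\<close> used throughout numbers the coordinates: \<open>z $ e \<xi>\<close> is the
  coordinate \<open>z\<^sub>\<xi>\<close>, for \<open>\<xi>\<close> from 1 to \<open>n = CARD('n)\<close>.
\<close>

definition domain_in :: "(complex^'n) set \<Rightarrow> bool" where
  "domain_in D \<longleftrightarrow> open D \<and> connected D \<and> D \<noteq> {}"

definition dir_deriv ::
  "complex^'n \<Rightarrow> (complex^'n \<Rightarrow> complex) \<Rightarrow> complex^'n \<Rightarrow> complex" where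
  "dir_deriv v f z = vector_derivative (\<lambda>t::real. f (z + t *\<^sub>R v)) (at 0)"

text \<open>Wirtinger derivatives; the directions \<open>axis i 1\<close> and \<open>axis i \<i>\<close> give the partial
  derivatives in the real and in the imaginary part of coordinate \<open>i\<close>.\<close>

definition dz :: "'n::finite \<Rightarrow> (complex^'n \<Rightarrow> complex) \<Rightarrow> complex^'n \<Rightarrow> complex" where
  "dz i f = (\<lambda>z. (dir_deriv (axis i 1) f z - \<i> * dir_deriv (axis i \<i>) f z) / 2)"

definition dzbar :: "'n::finite \<Rightarrow> (complex^'n \<Rightarrow> complex) \<Rightarrow> complex^'n \<Rightarrow> complex" where
  "dzbar i f = (\<lambda>z. (dir_deriv (axis i 1) f z + \<i> * dir_deriv (axis i \<i>) f z) / 2)"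

definition twice_R_differentiable_on ::
  "(complex^'n \<Rightarrow> complex) \<Rightarrow> (complex^'n) set \<Rightarrow> bool" where
  "twice_R_differentiable_on f D \<longleftrightarrow>
     f differentiable_on D \<and>
     (\<forall>i. dz i f differentiable_on D \<and> dzbar i f differentiable_on D)"

subsection \<open>The linear homogeneous system\<close>

text \<open>The coefficients are \<open>u j p\<close> with \<open>1 \<le> j \<le> m\<close> and \<open>1 \<le> p \<le> 2n\<close>.\<close>

definition op_apply ::
  "(nat \<Rightarrow> 'n::finite) \<Rightarrow> (nat \<Rightarrow> nat \<Rightarrow> complex^'n \<Rightarrow> complex) \<Rightarrow> nat
     \<Rightarrow> (complex^'n \<Rightarrow> complex) \<Rightarrow> complex^'n \<Rightarrow> complex" where
  "op_apply e u j f z =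
     (\<Sum>\<xi>=1..CARD('n). u j \<xi> z * dz (e \<xi>) f z + u j (CARD('n) + \<xi>) z * dzbar (e \<xi>) f z)"

definition linearly_bound ::
  "nat \<Rightarrow> (nat \<Rightarrow> nat \<Rightarrow> complex^'n::finite \<Rightarrow> complex) \<Rightarrow> (complex^'n) set \<Rightarrow> bool" where
  "linearly_bound m u D \<longleftrightarrow>
     (\<forall>z\<in>D. \<exists>c::nat \<Rightarrow> complex. (\<exists>j\<in>{1..m}. c j \<noteq> 0) \<and>
        (\<forall>p\<in>{1..2 * CARD('n)}. (\<Sum>j=1..m. c j * u j p z) = 0))"

text \<open>\<open>\<Phi> j w z\<close> is \<open>\<Phi>\<^sub>j(w; z)\<close>; no regularity is required of \<open>\<Phi>\<close>.\<close>

definition partial_integral ::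
  "(nat \<Rightarrow> 'n::finite) \<Rightarrow> nat \<Rightarrow> (nat \<Rightarrow> nat \<Rightarrow> complex^'n \<Rightarrow> complex) \<Rightarrow> (complex^'n) set
     \<Rightarrow> (complex^'n \<Rightarrow> complex) \<Rightarrow> bool" where
  "partial_integral e m u D f \<longleftrightarrow>
     f differentiable_on D \<and> \<not> f constant_on D \<and>
     (\<exists>\<Phi>::nat \<Rightarrow> complex \<Rightarrow> complex^'n \<Rightarrow> complex. \<forall>j\<in>{1..m}. \<forall>z\<in>D.
        op_apply e u j f z = \<Phi> j (f z) z \<and> \<Phi> j 0 z = 0)"

subsection \<open>Cylindricality functions\<close>

definition cylindrical ::
  "(nat \<Rightarrow> 'n::finite) \<Rightarrow> (nat \<Rightarrow> nat) \<Rightarrow> nat \<Rightarrow> nat \<Rightarrow> (complex^'n) set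
     \<Rightarrow> (complex^'n \<Rightarrow> complex) \<Rightarrow> bool" where
  "cylindrical e \<zeta> k1 k2 D f \<longleftrightarrow>
     f differentiable_on D \<and>
     (\<forall>\<gamma>\<in>{k1<..CARD('n)}. \<forall>z\<in>D. dz (e \<gamma>) f z = 0) \<and>
     (\<forall>\<delta>\<in>{k2<..CARD('n)}. \<forall>z\<in>D. dzbar (e (\<zeta> \<delta>)) f z = 0)"

subsection \<open>The functional system\<close>

text \<open>The function \<open>g\<close> is R-differentiable and its pure derivatives of order at most
  \<open>k1 + k2 - 1\<close> occurring in the functional system exist: an iterate is differentiated
  again only where it is itself R-differentiable.\<close>

definition system_derivs_exist ::
  "(nat \<Rightarrow> 'n::finite) \<Rightarrow> (nat \<Rightarrow> nat) \<Rightarrow> nat \<Rightarrow> nat \<Rightarrow> (complex^'n) set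
     \<Rightarrow> (complex^'n \<Rightarrow> complex) \<Rightarrow> bool" where
  "system_derivs_exist e \<zeta> k1 k2 D g \<longleftrightarrow>
     g differentiable_on D \<and>
     (\<forall>l < k1 + k2 - 1.
        (\<forall>\<gamma>\<in>{k1<..CARD('n)}. (dz (e \<gamma>) ^^ l) g differentiable_on D) \<and>
        (\<forall>\<delta>\<in>{k2<..CARD('n)}. (dzbar (e (\<zeta> \<delta>)) ^^ l) g differentiable_on D))"

text \<open>The product of the vector \<open>(\<phi>1, \<phi>2)\<close> with the vector obtained by applying \<open>T\<close> to
  each of the \<open>k1 + k2\<close> selected coefficients of the \<open>j\<close>-th operator.\<close>

definition coeff_dot ::
  "(nat \<Rightarrow> nat) \<Rightarrow> nat \<Rightarrow> nat \<Rightarrow> (nat \<Rightarrow> nat \<Rightarrow> complex^'n::finite \<Rightarrow> complex)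
     \<Rightarrow> (nat \<Rightarrow> complex^'n \<Rightarrow> complex) \<Rightarrow> (nat \<Rightarrow> complex^'n \<Rightarrow> complex)
     \<Rightarrow> ((complex^'n \<Rightarrow> complex) \<Rightarrow> complex^'n \<Rightarrow> complex) \<Rightarrow> nat \<Rightarrow> complex^'n \<Rightarrow> complex" where
  "coeff_dot \<zeta> k1 k2 u \<phi>1 \<phi>2 T j z =
     (\<Sum>\<xi>=1..k1. \<phi>1 \<xi> z * T (u j \<xi>) z) +
     (\<Sum>\<tau>=1..k2. \<phi>2 \<tau> z * T (u j (CARD('n) + \<zeta> \<tau>)) z)"

text \<open>Derivatives of \<open>H\<^sub>j = H\<^sub>j(f; z)\<close>, and its R-differentiability, refer to the function
  \<open>z \<mapsto> H\<^sub>j(f(z); z)\<close>.\<close>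

definition functional_system ::
  "(nat \<Rightarrow> 'n::finite) \<Rightarrow> (nat \<Rightarrow> nat) \<Rightarrow> nat \<Rightarrow> nat \<Rightarrow> nat
     \<Rightarrow> (nat \<Rightarrow> nat \<Rightarrow> complex^'n \<Rightarrow> complex) \<Rightarrow> (complex^'n) set \<Rightarrow> (complex^'n \<Rightarrow> complex)
     \<Rightarrow> (nat \<Rightarrow> complex^'n \<Rightarrow> complex) \<Rightarrow> (nat \<Rightarrow> complex^'n \<Rightarrow> complex)
     \<Rightarrow> (nat \<Rightarrow> complex \<Rightarrow> complex^'n \<Rightarrow> complex) \<Rightarrow> bool" where
  "functional_system e \<zeta> k1 k2 m u D f \<phi>1 \<phi>2 H \<longleftrightarrow>
     (\<forall>\<xi>\<in>{1..k1}. cylindrical e \<zeta> k1 k2 D (\<phi>1 \<xi>)) \<and>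
     (\<forall>\<tau>\<in>{1..k2}. cylindrical e \<zeta> k1 k2 D (\<phi>2 \<tau>)) \<and>
     (\<forall>j\<in>{1..m}.
        (\<forall>z\<in>D. H j 0 z = 0) \<and>
        system_derivs_exist e \<zeta> k1 k2 D (\<lambda>z. H j (f z) z) \<and>
        (\<forall>z\<in>D. coeff_dot \<zeta> k1 k2 u \<phi>1 \<phi>2 (\<lambda>g. g) j z = H j (f z) z) \<and>
        (\<forall>l\<in>{1..k1 + k2 - 1}. \<forall>\<gamma>\<in>{k1<..CARD('n)}. \<forall>z\<in>D.
           coeff_dot \<zeta> k1 k2 u \<phi>1 \<phi>2 (dz (e \<gamma>) ^^ l) j z
             = (dz (e \<gamma>) ^^ l) (\<lambda>z. H j (f z) z) z) \<and>
        (\<forall>l\<in>{1..k1 + k2 - 1}. \<forall>\<delta>\<in>{k2<..CARD('n)}. \<forall>z\<in>D.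
           coeff_dot \<zeta> k1 k2 u \<phi>1 \<phi>2 (dzbar (e (\<zeta> \<delta>)) ^^ l) j z
             = (dzbar (e (\<zeta> \<delta>)) ^^ l) (\<lambda>z. H j (f z) z) z))"

subsection \<open>The Pfaffian equation\<close>

text \<open>The complex-valued one-form at \<open>z\<close>, evaluated at the real tangent vector \<open>v\<close>.\<close>

definition pfaff_form ::
  "(nat \<Rightarrow> 'n::finite) \<Rightarrow> (nat \<Rightarrow> nat) \<Rightarrow> nat \<Rightarrow> nat
     \<Rightarrow> (nat \<Rightarrow> complex^'n \<Rightarrow> complex) \<Rightarrow> (nat \<Rightarrow> complex^'n \<Rightarrow> complex)
     \<Rightarrow> complex^'n \<Rightarrow> complex^'n \<Rightarrow> complex" where
  "pfaff_form e \<zeta> k1 k2 \<phi>1 \<phi>2 z v =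
     (\<Sum>\<xi>=1..k1. \<phi>1 \<xi> z * (v $ e \<xi>)) + (\<Sum>\<tau>=1..k2. \<phi>2 \<tau> z * cnj (v $ e (\<zeta> \<tau>)))"

definition integrates ::
  "(nat \<Rightarrow> 'n::finite) \<Rightarrow> (nat \<Rightarrow> nat) \<Rightarrow> nat \<Rightarrow> nat \<Rightarrow> (complex^'n) set
     \<Rightarrow> (nat \<Rightarrow> complex^'n \<Rightarrow> complex) \<Rightarrow> (nat \<Rightarrow> complex^'n \<Rightarrow> complex)
     \<Rightarrow> (complex^'n \<Rightarrow> complex) \<Rightarrow> (complex^'n \<Rightarrow> complex) \<Rightarrow> bool" where
  "integrates e \<zeta> k1 k2 D \<phi>1 \<phi>2 \<mu> f \<longleftrightarrow>
     cylindrical e \<zeta> k1 k2 D \<mu> \<and> (\<forall>z\<in>D. \<mu> z \<noteq> 0) \<and>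
     cylindrical e \<zeta> k1 k2 D f \<and>
     (\<forall>z\<in>D. (f has_derivative (\<lambda>v. \<mu> z * pfaff_form e \<zeta> k1 k2 \<phi>1 \<phi>2 z v)) (at z))"

definition integrating_factor ::
  "(nat \<Rightarrow> 'n::finite) \<Rightarrow> (nat \<Rightarrow> nat) \<Rightarrow> nat \<Rightarrow> nat \<Rightarrow> (complex^'n) set
     \<Rightarrow> (nat \<Rightarrow> complex^'n \<Rightarrow> complex) \<Rightarrow> (nat \<Rightarrow> complex^'n \<Rightarrow> complex)
     \<Rightarrow> (complex^'n \<Rightarrow> complex) \<Rightarrow> bool" where
  "integrating_factor e \<zeta> k1 k2 D \<phi>1 \<phi>2 \<mu> \<longleftrightarrow> (\<exists>f. integrates e \<zeta> k1 k2 D \<phi>1 \<phi>2 \<mu> f)"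

definition general_integral ::
  "(nat \<Rightarrow> 'n::finite) \<Rightarrow> (nat \<Rightarrow> nat) \<Rightarrow> nat \<Rightarrow> nat \<Rightarrow> (complex^'n) set
     \<Rightarrow> (nat \<Rightarrow> complex^'n \<Rightarrow> complex) \<Rightarrow> (nat \<Rightarrow> complex^'n \<Rightarrow> complex)
     \<Rightarrow> (complex^'n \<Rightarrow> complex) \<Rightarrow> bool" where
  "general_integral e \<zeta> k1 k2 D \<phi>1 \<phi>2 f \<longleftrightarrow>
     \<not> f constant_on D \<and> (\<exists>\<mu>. integrates e \<zeta> k1 k2 D \<phi>1 \<phi>2 \<mu> f)"

end

theory Submission imports Defs
begin

text \<open>
  A cylindricality function has only \<open>k1 + k2\<close> possibly nonzero Wirtinger derivatives, and its
  differential is the one-form with these derivatives as coefficients.  A partial integral \<open>f\<close>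
  therefore yields a solution of the functional system by taking these derivatives as the unknowns
  \<open>\<phi>\<close>, the function \<open>\<Phi>\<^sub>j\<close> as \<open>H\<^sub>j\<close>, and the integrating factor \<open>1\<close>.  The undifferentiated
  equations say \<open>\<AA>\<^sub>j f = \<Phi>\<^sub>j(f; z)\<close> (lemma \<open>op_apply_cylindrical\<close>).  The differentiated ones follow
  from the product rule, provided that the derivatives of \<open>f\<close> are again cylindricality functions,
  because the unknowns then act as constants (lemma \<open>coeff_dot_wirtinger_power\<close>).

  This proviso is the analytic core: from \<open>\<partial>f = 0\<close> in one direction one must infer that \<open>\<partial>\<close> also
  annihilates the other derivatives of \<open>f\<close>, that is, Wirtinger derivatives must commute.  The first
  derivatives are only assumed differentiable, not continuously differentiable, so the appropriate
  tool is the symmetry of second derivatives at a point in its strong form (lemma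
  \<open>symmetric_mixed_derivative\<close>), obtained from the second difference quotient.

  Conversely, \<open>df = \<mu> \<omega>\<close> determines the Wirtinger derivatives of \<open>f\<close> as \<open>\<mu>\<close> times the unknowns.
  They are differentiable because \<open>\<mu>\<close> and the unknowns are, and \<open>\<AA>\<^sub>j f = \<mu> H\<^sub>j(f; z)\<close>, which vanishes
  where \<open>f\<close> does; hence \<open>f\<close> is a partial integral with \<open>\<Phi>\<^sub>j = \<mu> H\<^sub>j\<close>.
\<close>

section \<open>Symmetry of second derivatives\<close>

text \<open>
  The second difference of \<open>f\<close> over the parallelogram spanned by \<open>t a\<close> and \<open>t b\<close> is the increment
  over \<open>0 \<le> s \<le> t\<close> of \<open>h s = f (z + s a + t b) - f (z + s a)\<close>.  The derivative of \<open>h\<close> is a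
  difference of two values of the directional derivative \<open>\<lambda>x. f' x a\<close> near \<open>z\<close>, hence equal to
  \<open>t A b\<close> up to \<open>o(t)\<close>, uniformly in \<open>s\<close>, by the differentiability of
  \<open>\<lambda>x. f' x a\<close> at the single point \<open>z\<close>.  The mean value inequality gives the limit.
\<close>

lemma second_difference_tendsto:
  fixes f :: "'a::real_normed_vector \<Rightarrow> 'b::real_inner"
  assumes "open D" and "z \<in> D"
    and f': "\<And>x. x \<in> D \<Longrightarrow> (f has_derivative f' x) (at x)"
    and A: "((\<lambda>x. f' x a) has_derivative A) (at z)"
  shows "((\<lambda>t. (f (z + t *\<^sub>R a + t *\<^sub>R b) - f (z + t *\<^sub>R a) - f (z + t *\<^sub>R b) + f z) /\<^sub>R t\<^sup>2)
           \<longlongrightarrow> A b) (at_right 0)"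
proof (rule tendstoI)
  fix \<epsilon> :: real assume "\<epsilon> > 0"
  \<comment> \<open>\<open>2 |a| + |b|\<close> comes from adding the remainders at \<open>s a + t b\<close> and at \<open>s a\<close>; the \<open>1\<close> keeps \<open>M\<close>
    positive when \<open>a\<close> and \<open>b\<close> vanish\<close>
  define M where "M = 2 * norm a + norm b + 1"
  define \<eta> where "\<eta> = \<epsilon> / (2 * M)"
  have M: "M > 0" unfolding M_def by (smt (verit) norm_ge_zero)
  have \<eta>: "\<eta> > 0" using \<open>\<epsilon> > 0\<close> M by (simp add: \<eta>_def)
  have linA: "linear A" using A has_derivative_linear by blast
  obtain d1 where d1: "d1 > 0" "ball z d1 \<subseteq> D"
    using \<open>open D\<close> \<open>z \<in> D\<close> openE by blast
  obtain d2 where d2: "d2 > 0"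
    and rem: "\<And>y. norm (y - z) < d2 \<Longrightarrow> norm (f' y a - f' z a - A (y - z)) \<le> \<eta> * norm (y - z)"
    using A \<eta> unfolding has_derivative_at_alt by blast
  define \<delta> where "\<delta> = min d1 d2 / M"
  have \<delta>: "\<delta> > 0" using d1 d2 M by (simp add: \<delta>_def)
  have close: "norm ((f (z + t *\<^sub>R a + t *\<^sub>R b) - f (z + t *\<^sub>R a) - f (z + t *\<^sub>R b) + f z) /\<^sub>R t\<^sup>2 - A b) < \<epsilon>"
    if t: "0 < t" "t < \<delta>" for t
  proof -
    have tM: "t * M < min d1 d2" using t M by (simp add: \<delta>_def field_simps)
    have norm1: "norm (s *\<^sub>R a) \<le> t * norm a" if "0 \<le> s" "s \<le> t" for s
      using that by (simp add: mult_right_mono)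
    have norm2: "norm (s *\<^sub>R a + t *\<^sub>R b) \<le> t * (norm a + norm b)" if "0 \<le> s" "s \<le> t" for s
      using norm_triangle_ineq[of "s *\<^sub>R a" "t *\<^sub>R b"] norm1[OF that] t by (simp add: distrib_left)
    have bound1: "t * norm a \<le> t * M" "t * (norm a + norm b) \<le> t * M"
      using t unfolding M_def by (auto intro!: mult_left_mono)
    have near1: "norm (s *\<^sub>R a) < min d1 d2" if "0 \<le> s" "s \<le> t" for s
      using norm1[OF that] bound1 tM by linarith
    have near2: "norm (s *\<^sub>R a + t *\<^sub>R b) < min d1 d2" if "0 \<le> s" "s \<le> t" for s
      using norm2[OF that] bound1 tM by linarith
    have inD1: "z + s *\<^sub>R a \<in> D" if "0 \<le> s" "s \<le> t" for s
      using d1(2) near1[OF that] by (auto simp: dist_norm subset_iff)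
    have inD2: "z + s *\<^sub>R a + t *\<^sub>R b \<in> D" if "0 \<le> s" "s \<le> t" for s
      using d1(2) near2[OF that]
      by (metis (no_types, lifting) add.assoc add_diff_cancel_left' dist_commute dist_norm
          mem_ball min_less_iff_conj subsetD)
    \<comment> \<open>subtracting the expected linear growth turns the claim into a smallness bound\<close>
    define h where "h s = f (z + s *\<^sub>R a + t *\<^sub>R b) - f (z + s *\<^sub>R a) - (s * t) *\<^sub>R A b" for s
    define h' where "h' s r = r *\<^sub>R (f' (z + s *\<^sub>R a + t *\<^sub>R b) a - f' (z + s *\<^sub>R a) a - t *\<^sub>R A b)"
      for s r
    have h': "(h has_derivative h' s) (at s)" if s: "0 \<le> s" "s \<le> t" for s
    proof -
      have lin1: "linear (f' (z + s *\<^sub>R a + t *\<^sub>R b))" and lin2: "linear (f' (z + s *\<^sub>R a))"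
        using f'[OF inD1[OF s]] f'[OF inD2[OF s]] has_derivative_linear by blast+
      have 1: "((\<lambda>s. f (z + s *\<^sub>R a + t *\<^sub>R b)) has_derivative
                 (\<lambda>r. f' (z + s *\<^sub>R a + t *\<^sub>R b) (r *\<^sub>R a))) (at s)"
        by (rule has_derivative_compose[where f = "\<lambda>s. z + s *\<^sub>R a + t *\<^sub>R b"])
          (auto intro!: derivative_eq_intros f'[OF inD2[OF s]])
      have 2: "((\<lambda>s. f (z + s *\<^sub>R a)) has_derivative (\<lambda>r. f' (z + s *\<^sub>R a) (r *\<^sub>R a))) (at s)"
        by (rule has_derivative_compose[where f = "\<lambda>s. z + s *\<^sub>R a"])
          (auto intro!: derivative_eq_intros f'[OF inD1[OF s]])
      have 3: "((\<lambda>s. (s * t) *\<^sub>R A b) has_derivative (\<lambda>r. (r * t) *\<^sub>R A b)) (at s)"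
        by (auto intro!: derivative_eq_intros)
      have "(h has_derivative (\<lambda>r. f' (z + s *\<^sub>R a + t *\<^sub>R b) (r *\<^sub>R a) - f' (z + s *\<^sub>R a) (r *\<^sub>R a)
               - (r * t) *\<^sub>R A b)) (at s)"
        unfolding h_def by (intro has_derivative_diff 1 2 3)
      then show ?thesis
        by (simp add: h'_def[abs_def] linear_scale[OF lin1] linear_scale[OF lin2] scaleR_diff_right)
    qed
    obtain s where s: "s \<in> {0<..<t}" and mv: "norm (h t - h 0) \<le> norm (h' s (t - 0))"
    proof -
      have "continuous_on {0..t} h"
        by (rule has_derivative_continuous_on[of _ _ h']) (auto intro: has_derivative_at_withinI h')
      then show thesis using mvt_general[of 0 t h h'] t h' that by auto
    qed
    have s01: "0 \<le> s" "s \<le> t" using s by auto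
    have "norm (f' (z + s *\<^sub>R a + t *\<^sub>R b) a - f' (z + s *\<^sub>R a) a - t *\<^sub>R A b) \<le> \<eta> * (t * M)"
    proof -
      define r1 where "r1 = f' (z + s *\<^sub>R a + t *\<^sub>R b) a - f' z a - A (s *\<^sub>R a + t *\<^sub>R b)"
      define r2 where "r2 = f' (z + s *\<^sub>R a) a - f' z a - A (s *\<^sub>R a)"
      have "norm r1 \<le> \<eta> * norm (s *\<^sub>R a + t *\<^sub>R b)"
        using rem[of "z + s *\<^sub>R a + t *\<^sub>R b"] near2[OF s01] by (simp add: r1_def add.assoc)
      also have "\<dots> \<le> \<eta> * (t * (norm a + norm b))" using norm2[OF s01] \<eta> by (simp add: mult_left_mono)
      finally have n1: "norm r1 \<le> \<eta> * (t * (norm a + norm b))" .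
      have "norm r2 \<le> \<eta> * norm (s *\<^sub>R a)"
        using rem[of "z + s *\<^sub>R a"] near1[OF s01] by (simp add: r2_def)
      also have "\<dots> \<le> \<eta> * (t * norm a)" using norm1[OF s01] \<eta> by (simp add: mult_left_mono)
      finally have n2: "norm r2 \<le> \<eta> * (t * norm a)" .
      have "f' (z + s *\<^sub>R a + t *\<^sub>R b) a - f' (z + s *\<^sub>R a) a - t *\<^sub>R A b = r1 - r2"
        by (simp add: r1_def r2_def linear_add[OF linA] linear_scale[OF linA])
      also have "norm \<dots> \<le> norm r1 + norm r2" by (rule norm_triangle_ineq4)
      also have "\<dots> \<le> \<eta> * (t * (norm a + norm b)) + \<eta> * (t * norm a)" using n1 n2 by simp
      also have "\<dots> = \<eta> * (t * (M - 1))" by (simp add: M_def algebra_simps)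
      also have "\<dots> \<le> \<eta> * (t * M)" using \<eta> t by simp
      finally show ?thesis .
    qed
    then have "norm (h' s (t - 0)) \<le> t * (\<eta> * (t * M))" using t by (simp add: h'_def mult_left_mono)
    then have main: "norm (h t - h 0) \<le> t\<^sup>2 * (\<eta> * M)"
      using mv by (simp add: power2_eq_square algebra_simps)
    have "(f (z + t *\<^sub>R a + t *\<^sub>R b) - f (z + t *\<^sub>R a) - f (z + t *\<^sub>R b) + f z) /\<^sub>R t\<^sup>2 - A b
          = (h t - h 0) /\<^sub>R t\<^sup>2"
      using t by (simp add: h_def algebra_simps power2_eq_square)
    also have "norm \<dots> = norm (h t - h 0) / t\<^sup>2"
      using t by (simp add: divide_inverse mult.commute)
    also have "\<dots> \<le> \<eta> * M" using main t by (simp add: pos_divide_le_eq mult.commute)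
    also have "\<dots> < \<epsilon>" using \<open>\<epsilon> > 0\<close> M by (simp add: \<eta>_def)
    finally show ?thesis .
  qed
  show "\<forall>\<^sub>F t in at_right 0. dist ((f (z + t *\<^sub>R a + t *\<^sub>R b) - f (z + t *\<^sub>R a) - f (z + t *\<^sub>R b) + f z)
          /\<^sub>R t\<^sup>2) (A b) < \<epsilon>"
    unfolding eventually_at_right_field dist_norm using \<delta> close by blast
qed

text \<open>The second difference does not change when the two directions are exchanged, so both mixed
  derivatives are its limit.\<close>

lemma symmetric_mixed_derivative:
  fixes f :: "'a::real_normed_vector \<Rightarrow> 'b::real_inner"
  assumes "open D" and "z \<in> D"
    and "\<And>x. x \<in> D \<Longrightarrow> (f has_derivative f' x) (at x)"
    and "((\<lambda>x. f' x a) has_derivative A) (at z)"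
    and "((\<lambda>x. f' x b) has_derivative B) (at z)"
  shows "A b = B a"
proof -
  have "((\<lambda>t. (f (z + t *\<^sub>R a + t *\<^sub>R b) - f (z + t *\<^sub>R a) - f (z + t *\<^sub>R b) + f z) /\<^sub>R t\<^sup>2)
           \<longlongrightarrow> A b) (at_right 0)"
    by (rule second_difference_tendsto[OF assms(1-4)])
  moreover have "((\<lambda>t. (f (z + t *\<^sub>R a + t *\<^sub>R b) - f (z + t *\<^sub>R a) - f (z + t *\<^sub>R b) + f z) /\<^sub>R t\<^sup>2)
           \<longlongrightarrow> B a) (at_right 0)"
    using second_difference_tendsto[OF assms(1-3,5), of a] by (simp add: algebra_simps)
  ultimately show ?thesis
    using tendsto_unique trivial_limit_at_right_real by blast
qed

section \<open>Wirtinger derivatives\<close>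

text \<open>The two Wirtinger derivatives are the cases \<open>c = -\<i>\<close> and \<open>c = \<i>\<close> of one operator, so that each
  rule below is proved once for both.\<close>

definition wirtinger ::
  "complex \<Rightarrow> 'n::finite \<Rightarrow> (complex^'n \<Rightarrow> complex) \<Rightarrow> complex^'n \<Rightarrow> complex" where
  "wirtinger c i f = (\<lambda>z. (dir_deriv (axis i 1) f z + c * dir_deriv (axis i \<i>) f z) / 2)"

lemma dz_eq_wirtinger: "dz = wirtinger (- \<i>)"
  by (simp add: fun_eq_iff dz_def wirtinger_def)

lemma dzbar_eq_wirtinger: "dzbar = wirtinger \<i>"
  by (simp add: fun_eq_iff dzbar_def wirtinger_def)

lemma dir_deriv_eq:
  assumes "(f has_derivative f') (at z)"
  shows "dir_deriv v f z = f' v"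
proof -
  have "((\<lambda>t::real. f (z + t *\<^sub>R v)) has_derivative (\<lambda>t. f' (t *\<^sub>R v))) (at 0)"
    by (rule has_derivative_compose[where g = f]) (auto intro!: derivative_eq_intros assms)
  then have "((\<lambda>t::real. f (z + t *\<^sub>R v)) has_vector_derivative f' v) (at 0)"
    using linear_scale[OF has_derivative_linear[OF assms]] by (simp add: has_vector_derivative_def)
  then show ?thesis by (simp add: dir_deriv_def vector_derivative_at)
qed

lemma wirtinger_eq:
  assumes "(f has_derivative f') (at z)"
  shows "wirtinger c i f z = (f' (axis i 1) + c * f' (axis i \<i>)) / 2"
  by (simp add: wirtinger_def dir_deriv_eq[OF assms])

lemma wirtinger_cong:
  assumes "open D" and "z \<in> D" and "\<And>x. x \<in> D \<Longrightarrow> f x = g x"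
  shows "wirtinger c i f z = wirtinger c i g z"
proof -
  have "dir_deriv v f z = dir_deriv v g z" for v
  proof -
    have "((\<lambda>t::real. z + t *\<^sub>R v) \<longlongrightarrow> z) (nhds 0)"
      by (auto intro!: tendsto_eq_intros filterlim_ident)
    then have "\<forall>\<^sub>F t::real in nhds 0. z + t *\<^sub>R v \<in> D"
      using topological_tendstoD assms(1,2) by blast
    then have "\<forall>\<^sub>F t::real in nhds 0. t \<in> UNIV \<longrightarrow> f (z + t *\<^sub>R v) = g (z + t *\<^sub>R v)"
      by eventually_elim (simp add: assms(3))
    then show ?thesis unfolding dir_deriv_def by (rule vector_derivative_cong_eq) auto
  qed
  then show ?thesis by (simp add: wirtinger_def)
qed

lemma wirtinger_const [simp]: "wirtinger c i (\<lambda>z. k) z = 0"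
  by (simp add: wirtinger_eq[OF has_derivative_const])

lemma wirtinger_add:
  assumes "f differentiable at z" and "g differentiable at z"
  shows "wirtinger c i (\<lambda>z. f z + g z) z = wirtinger c i f z + wirtinger c i g z"
proof -
  obtain f' g' where 1: "(f has_derivative f') (at z)" and 2: "(g has_derivative g') (at z)"
    using assms by (auto simp: differentiable_def)
  show ?thesis
    by (simp add: wirtinger_eq[OF has_derivative_add[OF 1 2]] wirtinger_eq[OF 1] wirtinger_eq[OF 2]
        field_simps)
qed

lemma wirtinger_mult:
  assumes "f differentiable at z" and "g differentiable at z"
  shows "wirtinger c i (\<lambda>z. f z * g z) z = f z * wirtinger c i g z + wirtinger c i f z * g z"
proof -
  obtain f' g' where 1: "(f has_derivative f') (at z)" and 2: "(g has_derivative g') (at z)"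
    using assms by (auto simp: differentiable_def)
  show ?thesis
    by (simp add: wirtinger_eq[OF has_derivative_mult[OF 1 2]] wirtinger_eq[OF 1] wirtinger_eq[OF 2]
        field_simps)
qed

lemma wirtinger_sum_mult:
  assumes "finite S"
    and "\<And>s. s \<in> S \<Longrightarrow> \<phi> s differentiable at z" and "\<And>s. s \<in> S \<Longrightarrow> g s differentiable at z"
    and "\<And>s. s \<in> S \<Longrightarrow> wirtinger c i (\<phi> s) z = 0"
  shows "wirtinger c i (\<lambda>z. \<Sum>s\<in>S. \<phi> s z * g s z) z = (\<Sum>s\<in>S. \<phi> s z * wirtinger c i (g s) z)"
  using assms
proof (induction S rule: finite_induct)
  case (insert s S)
  then have "wirtinger c i (\<lambda>z. \<phi> s z * g s z + (\<Sum>s\<in>S. \<phi> s z * g s z)) z =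
    wirtinger c i (\<lambda>z. \<phi> s z * g s z) z + wirtinger c i (\<lambda>z. \<Sum>s\<in>S. \<phi> s z * g s z) z"
    by (intro wirtinger_add) (auto intro!: differentiable_mult differentiable_sum)
  then show ?case using insert by (simp add: wirtinger_mult)
qed simp

lemma differentiable_on_eq:
  assumes "f differentiable_on D" and "\<And>x. x \<in> D \<Longrightarrow> g x = f x"
  shows "g differentiable_on D"
  unfolding differentiable_on_def
proof
  fix x assume "x \<in> D"
  then show "g differentiable at x within D"
    using assms(1) by (intro differentiable_transform_within[of f x D 1 g])
      (auto simp: differentiable_on_def assms(2))
qed

text \<open>Both sides are combinations of the second derivatives in the directions \<open>axis i 1\<close>,
  \<open>axis i \<i>\<close>, \<open>axis j 1\<close>, \<open>axis j \<i>\<close>, whose symmetry is known.\<close>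

lemma wirtinger_commute:
  assumes "open D" and "z \<in> D" and f: "twice_R_differentiable_on f D"
  shows "wirtinger c i (wirtinger d j f) z = wirtinger d j (wirtinger c i f) z"
proof -
  obtain f' where f': "\<And>x. x \<in> D \<Longrightarrow> (f has_derivative f' x) (at x)"
    using f assms(1) unfolding twice_R_differentiable_on_def differentiable_on_eq_differentiable_at[OF assms(1)]
      differentiable_def by metis
  have diff: "(\<lambda>x. f' x (axis k 1)) differentiable at z \<and> (\<lambda>x. f' x (axis k \<i>)) differentiable at z"
    for k
  proof -
    \<comment> \<open>differentiability is assumed of \<open>dz\<close> and \<open>dzbar\<close>, from which the real partial derivatives are
      recovered as linear combinations\<close>
    have d: "dz k f differentiable_on D" "dzbar k f differentiable_on D"
      using f by (auto simp: twice_R_differentiable_on_def)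
    have e1: "f' x (axis k 1) = dz k f x + dzbar k f x"
      and e2: "f' x (axis k \<i>) = \<i> * (dz k f x - dzbar k f x)" if "x \<in> D" for x
      by (simp_all add: dz_eq_wirtinger dzbar_eq_wirtinger wirtinger_eq[OF f'[OF that]] field_simps)
    have "(\<lambda>x. f' x (axis k 1)) differentiable_on D"
      by (rule differentiable_on_eq[OF _ e1]) (use d in auto)
    moreover have "(\<lambda>x. f' x (axis k \<i>)) differentiable_on D"
      by (rule differentiable_on_eq[OF _ e2])
        (use d in \<open>auto intro!: differentiable_mult simp: differentiable_on_def\<close>)
    ultimately show ?thesis
      using assms(2) by (simp add: differentiable_on_eq_differentiable_at[OF assms(1)])
  qed
  define D2 where "D2 v = frechet_derivative (\<lambda>x. f' x v) (at z)" for v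
  have D2: "((\<lambda>x. f' x (axis k 1)) has_derivative D2 (axis k 1)) (at z)"
    "((\<lambda>x. f' x (axis k \<i>)) has_derivative D2 (axis k \<i>)) (at z)" for k
    using diff unfolding D2_def frechet_derivative_works[symmetric] by auto
  have sym: "D2 (axis k p) (axis l q) = D2 (axis l q) (axis k p)" if "p \<in> {1, \<i>}" "q \<in> {1, \<i>}" for k l p q
    using that by (auto intro!: symmetric_mixed_derivative[OF assms(1,2) f'] D2)
  have w: "wirtinger c k (wirtinger d l f) z =
     (D2 (axis l 1) (axis k 1) + d * D2 (axis l \<i>) (axis k 1) +
      c * (D2 (axis l 1) (axis k \<i>) + d * D2 (axis l \<i>) (axis k \<i>))) / 4" for c d k l
  proof -
    have hd: "((\<lambda>x. (f' x (axis l 1) + d * f' x (axis l \<i>)) / 2) has_derivative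
            (\<lambda>v. (D2 (axis l 1) v + d * D2 (axis l \<i>) v) / 2)) (at z)"
      by (auto intro!: derivative_eq_intros D2)
    have "wirtinger c k (\<lambda>x. (f' x (axis l 1) + d * f' x (axis l \<i>)) / 2) z =
     (D2 (axis l 1) (axis k 1) + d * D2 (axis l \<i>) (axis k 1) +
      c * (D2 (axis l 1) (axis k \<i>) + d * D2 (axis l \<i>) (axis k \<i>))) / 4"
      unfolding wirtinger_eq[OF hd] by (simp add: field_simps)
    moreover have "wirtinger c k (wirtinger d l f) z =
        wirtinger c k (\<lambda>x. (f' x (axis l 1) + d * f' x (axis l \<i>)) / 2) z"
      by (rule wirtinger_cong[OF assms(1,2)]) (simp add: wirtinger_eq[OF f'])
    ultimately show ?thesis by simp
  qed
  show ?thesis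
    unfolding w sym[of 1 1 i j, simplified] sym[of 1 \<i> i j, simplified] sym[of \<i> 1 i j, simplified]
      sym[of \<i> \<i> i j, simplified] by (simp add: algebra_simps)
qed

lemma has_derivative_expansion:
  assumes "(f has_derivative f') (at z)"
  shows "f' v = (\<Sum>i\<in>UNIV. dz i f z * v $ i + dzbar i f z * cnj (v $ i))"
proof -
  have lin: "linear f'" using assms has_derivative_linear by blast
  have "v = (\<Sum>i\<in>UNIV. Re (v $ i) *\<^sub>R axis i 1 + Im (v $ i) *\<^sub>R axis i \<i>)"
    unfolding vec_eq_iff
  proof
    fix k
    have "(\<Sum>i\<in>UNIV. Re (v $ i) *\<^sub>R axis i 1 + Im (v $ i) *\<^sub>R axis i \<i>) $ k
       = (\<Sum>i\<in>UNIV. if i = k then v $ k else 0)"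
      unfolding sum_component
      by (rule sum.cong) (auto simp: axis_def complex_eq_iff)
    then show "v $ k = (\<Sum>i\<in>UNIV. Re (v $ i) *\<^sub>R axis i 1 + Im (v $ i) *\<^sub>R axis i \<i>) $ k" by simp
  qed
  then have "f' v = f' (\<Sum>i\<in>UNIV. Re (v $ i) *\<^sub>R axis i 1 + Im (v $ i) *\<^sub>R axis i \<i>)"
    by (rule arg_cong)
  also have "\<dots> = (\<Sum>i\<in>UNIV. Re (v $ i) *\<^sub>R f' (axis i 1) + Im (v $ i) *\<^sub>R f' (axis i \<i>))"
    by (simp add: linear_sum[OF lin] linear_add[OF lin] linear_scale[OF lin])
  also have "\<dots> = (\<Sum>i\<in>UNIV. dz i f z * v $ i + dzbar i f z * cnj (v $ i))"
  proof (rule sum.cong)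
    fix i
    define p q where "p = Re (v $ i)" and "q = Im (v $ i)"
    have v: "v $ i = of_real p + \<i> * of_real q" "cnj (v $ i) = of_real p - \<i> * of_real q"
      by (simp_all add: p_def q_def complex_eq_iff)
    show "Re (v $ i) *\<^sub>R f' (axis i 1) + Im (v $ i) *\<^sub>R f' (axis i \<i>)
      = dz i f z * v $ i + dzbar i f z * cnj (v $ i)"
      unfolding p_def[symmetric] q_def[symmetric] v dz_eq_wirtinger dzbar_eq_wirtinger
        wirtinger_eq[OF assms] scaleR_conv_of_real
      by (simp add: field_simps)
  qed simp
  finally show ?thesis .
qed

section \<open>Cylindricality functions and the functional system\<close>

lemma sum_restrict_initial:
  fixes F :: "nat \<Rightarrow> 'a::comm_monoid_add"
  assumes "k \<le> n" and "\<And>i. i \<in> {k<..n} \<Longrightarrow> F i = 0"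
  shows "(\<Sum>i=1..n. F i) = (\<Sum>i=1..k. F i)"
  by (rule sum.mono_neutral_right) (use assms in auto)

text \<open>Permuting the barred coordinates by \<open>\<zeta>\<close> moves those that survive to the front.\<close>

lemma op_apply_cylindrical:
  fixes e :: "nat \<Rightarrow> 'n::finite"
  assumes \<zeta>: "\<zeta> permutes {1..CARD('n)}" and "k1 \<le> CARD('n)" and "k2 \<le> CARD('n)"
    and f: "cylindrical e \<zeta> k1 k2 D f" and "z \<in> D"
  shows "op_apply e u j f z =
    coeff_dot \<zeta> k1 k2 u (\<lambda>\<xi>. dz (e \<xi>) f) (\<lambda>\<tau>. dzbar (e (\<zeta> \<tau>)) f) (\<lambda>g. g) j z"
proof -
  have "(\<Sum>\<xi>=1..CARD('n). u j (CARD('n) + \<xi>) z * dzbar (e \<xi>) f z)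
      = (\<Sum>\<tau>=1..CARD('n). u j (CARD('n) + \<zeta> \<tau>) z * dzbar (e (\<zeta> \<tau>)) f z)"
    using sum.permute[OF \<zeta>] by (simp add: o_def)
  also have "\<dots> = (\<Sum>\<tau>=1..k2. u j (CARD('n) + \<zeta> \<tau>) z * dzbar (e (\<zeta> \<tau>)) f z)"
    by (rule sum_restrict_initial) (use assms in \<open>auto simp: cylindrical_def\<close>)
  moreover have "(\<Sum>\<xi>=1..CARD('n). u j \<xi> z * dz (e \<xi>) f z) = (\<Sum>\<xi>=1..k1. u j \<xi> z * dz (e \<xi>) f z)"
    by (rule sum_restrict_initial) (use assms in \<open>auto simp: cylindrical_def\<close>)
  ultimately show ?thesis
    by (simp add: op_apply_def coeff_dot_def sum.distrib mult.commute)
qed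

lemma cylindrical_has_derivative_pfaff_form:
  fixes e :: "nat \<Rightarrow> 'n::finite"
  assumes e: "bij_betw e {1..CARD('n)} UNIV" and \<zeta>: "\<zeta> permutes {1..CARD('n)}"
    and "k1 \<le> CARD('n)" and "k2 \<le> CARD('n)"
    and f: "cylindrical e \<zeta> k1 k2 D f" and "open D" and "z \<in> D"
  shows "(f has_derivative
    pfaff_form e \<zeta> k1 k2 (\<lambda>\<xi>. dz (e \<xi>) f) (\<lambda>\<tau>. dzbar (e (\<zeta> \<tau>)) f) z) (at z)"
proof -
  obtain f' where f': "(f has_derivative f') (at z)"
    using assms differentiable_on_eq_differentiable_at[of D f]
    unfolding cylindrical_def differentiable_def by auto
  have "f' v = pfaff_form e \<zeta> k1 k2 (\<lambda>\<xi>. dz (e \<xi>) f) (\<lambda>\<tau>. dzbar (e (\<zeta> \<tau>)) f) z v" for v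
  proof -
    have "(\<Sum>i\<in>UNIV. dz i f z * v $ i) = (\<Sum>\<xi>=1..CARD('n). dz (e \<xi>) f z * v $ e \<xi>)"
      by (rule sum.reindex_bij_betw[OF e, symmetric])
    also have "\<dots> = (\<Sum>\<xi>=1..k1. dz (e \<xi>) f z * v $ e \<xi>)"
      by (rule sum_restrict_initial) (use assms in \<open>auto simp: cylindrical_def\<close>)
    finally have 1: "(\<Sum>i\<in>UNIV. dz i f z * v $ i) = \<dots>" .
    have "(\<Sum>i\<in>UNIV. dzbar i f z * cnj (v $ i))
        = (\<Sum>\<xi>=1..CARD('n). dzbar (e \<xi>) f z * cnj (v $ e \<xi>))"
      by (rule sum.reindex_bij_betw[OF e, symmetric])
    also have "\<dots> = (\<Sum>\<tau>=1..CARD('n). dzbar (e (\<zeta> \<tau>)) f z * cnj (v $ e (\<zeta> \<tau>)))"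
      using sum.permute[OF \<zeta>] by (simp add: o_def)
    also have "\<dots> = (\<Sum>\<tau>=1..k2. dzbar (e (\<zeta> \<tau>)) f z * cnj (v $ e (\<zeta> \<tau>)))"
      by (rule sum_restrict_initial) (use assms in \<open>auto simp: cylindrical_def\<close>)
    finally have 2: "(\<Sum>i\<in>UNIV. dzbar i f z * cnj (v $ i)) = \<dots>" .
    show ?thesis
      unfolding has_derivative_expansion[OF f'] sum.distrib 1 2 pfaff_form_def ..
  qed
  then have "f' = pfaff_form e \<zeta> k1 k2 (\<lambda>\<xi>. dz (e \<xi>) f) (\<lambda>\<tau>. dzbar (e (\<zeta> \<tau>)) f) z" by blast
  then show ?thesis using f' by simp
qed

text \<open>The form and the derivatives are compared on the vectors \<open>axis i 1\<close> and \<open>axis i \<i>\<close>: the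
  combination defining \<open>dz\<close> cancels the conjugate-linear part, that defining \<open>dzbar\<close> the
  complex-linear part.\<close>

lemma wirtinger_of_pfaff_form:
  assumes f: "(f has_derivative (\<lambda>v. c * pfaff_form e \<zeta> k1 k2 \<phi>1 \<phi>2 z v)) (at z)"
  shows "dz i f z = c * (\<Sum>\<xi>=1..k1. if e \<xi> = i then \<phi>1 \<xi> z else 0)"
    and "dzbar i f z = c * (\<Sum>\<tau>=1..k2. if e (\<zeta> \<tau>) = i then \<phi>2 \<tau> z else 0)"
proof -
  define A where "A = (\<Sum>\<xi>=1..k1. if e \<xi> = i then \<phi>1 \<xi> z else 0)"
  define B where "B = (\<Sum>\<tau>=1..k2. if e (\<zeta> \<tau>) = i then \<phi>2 \<tau> z else 0)"
  have 1: "pfaff_form e \<zeta> k1 k2 \<phi>1 \<phi>2 z (axis i 1) = A + B"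
    unfolding pfaff_form_def A_def B_def by (auto simp: axis_def intro!: arg_cong2[of _ _ _ _ "(+)"] sum.cong)
  have 2: "pfaff_form e \<zeta> k1 k2 \<phi>1 \<phi>2 z (axis i \<i>) = \<i> * A - \<i> * B"
    unfolding pfaff_form_def A_def B_def sum_distrib_left diff_conv_add_uminus sum_negf[symmetric]
    by (auto simp: axis_def intro!: arg_cong2[of _ _ _ _ "(+)"] sum.cong)
  show "dz i f z = c * A" "dzbar i f z = c * B"
    unfolding dz_eq_wirtinger dzbar_eq_wirtinger wirtinger_eq[OF f] 1 2 by (simp_all add: algebra_simps)
qed

text \<open>Since \<open>T\<close> annihilates the unknowns, they behave like constants and pass through every
  power of \<open>T\<close>.\<close>

lemma coeff_dot_wirtinger_power:
  fixes u :: "nat \<Rightarrow> nat \<Rightarrow> complex^'n::finite \<Rightarrow> complex"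
  assumes "open D" and T: "T = wirtinger c i"
    and \<phi>1: "\<And>\<xi>. \<xi> \<in> {1..k1} \<Longrightarrow> \<phi>1 \<xi> differentiable_on D \<and> (\<forall>z\<in>D. T (\<phi>1 \<xi>) z = 0)"
    and \<phi>2: "\<And>\<tau>. \<tau> \<in> {1..k2} \<Longrightarrow> \<phi>2 \<tau> differentiable_on D \<and> (\<forall>z\<in>D. T (\<phi>2 \<tau>) z = 0)"
    and u1: "\<And>l \<xi>. l < N \<Longrightarrow> \<xi> \<in> {1..k1} \<Longrightarrow> (T ^^ l) (u j \<xi>) differentiable_on D"
    and u2: "\<And>l \<tau>. l < N \<Longrightarrow> \<tau> \<in> {1..k2} \<Longrightarrow>
               (T ^^ l) (u j (CARD('n) + \<zeta> \<tau>)) differentiable_on D"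
    and h: "\<And>z. z \<in> D \<Longrightarrow> h z = coeff_dot \<zeta> k1 k2 u \<phi>1 \<phi>2 (\<lambda>g. g) j z"
    and "l \<le> N" and "z \<in> D"
  shows "(T ^^ l) h z = coeff_dot \<zeta> k1 k2 u \<phi>1 \<phi>2 (T ^^ l) j z"
  using \<open>l \<le> N\<close> \<open>z \<in> D\<close>
proof (induction l arbitrary: z)
  case 0
  then show ?case using h by (simp add: coeff_dot_def)
next
  case (Suc l)
  note at = differentiable_on_eq_differentiable_at[OF \<open>open D\<close>]
  have d: "\<xi> \<in> {1..k1} \<Longrightarrow> \<phi>1 \<xi> differentiable at z"
    "\<xi> \<in> {1..k1} \<Longrightarrow> wirtinger c i (\<phi>1 \<xi>) z = 0"
    "\<xi> \<in> {1..k1} \<Longrightarrow> (T ^^ l) (u j \<xi>) differentiable at z"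
    "\<tau> \<in> {1..k2} \<Longrightarrow> \<phi>2 \<tau> differentiable at z"
    "\<tau> \<in> {1..k2} \<Longrightarrow> wirtinger c i (\<phi>2 \<tau>) z = 0"
    "\<tau> \<in> {1..k2} \<Longrightarrow> (T ^^ l) (u j (CARD('n) + \<zeta> \<tau>)) differentiable at z" for \<xi> \<tau>
    using \<phi>1 \<phi>2 u1[of l] u2[of l] Suc.prems unfolding at T by auto
  have "(T ^^ Suc l) h z = wirtinger c i ((T ^^ l) h) z" by (simp add: T)
  also have "\<dots> = wirtinger c i (coeff_dot \<zeta> k1 k2 u \<phi>1 \<phi>2 (T ^^ l) j) z"
    by (rule wirtinger_cong[OF \<open>open D\<close>]) (use Suc in auto)
  also have "\<dots> = wirtinger c i (\<lambda>z. \<Sum>\<xi>=1..k1. \<phi>1 \<xi> z * (T ^^ l) (u j \<xi>) z) z +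
      wirtinger c i (\<lambda>z. \<Sum>\<tau>=1..k2. \<phi>2 \<tau> z * (T ^^ l) (u j (CARD('n) + \<zeta> \<tau>)) z) z"
    unfolding coeff_dot_def[abs_def]
    by (rule wirtinger_add) (auto intro!: differentiable_sum differentiable_mult d)
  also have "\<dots> = coeff_dot \<zeta> k1 k2 u \<phi>1 \<phi>2 (T ^^ Suc l) j z"
  proof -
    have 1: "wirtinger c i (\<lambda>z. \<Sum>\<xi>=1..k1. \<phi>1 \<xi> z * (T ^^ l) (u j \<xi>) z) z =
        (\<Sum>\<xi>=1..k1. \<phi>1 \<xi> z * wirtinger c i ((T ^^ l) (u j \<xi>)) z)"
      by (rule wirtinger_sum_mult) (use d in auto)
    have 2: "wirtinger c i (\<lambda>z. \<Sum>\<tau>=1..k2. \<phi>2 \<tau> z * (T ^^ l) (u j (CARD('n) + \<zeta> \<tau>)) z) z =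
        (\<Sum>\<tau>=1..k2. \<phi>2 \<tau> z * wirtinger c i ((T ^^ l) (u j (CARD('n) + \<zeta> \<tau>))) z)"
      by (rule wirtinger_sum_mult) (use d in auto)
    show ?thesis unfolding 1 2 coeff_dot_def by (simp add: T)
  qed
  finally show ?case .
qed

lemma coeff_dot_differentiable:
  fixes u :: "nat \<Rightarrow> nat \<Rightarrow> complex^'n::finite \<Rightarrow> complex"
  assumes "\<And>\<xi>. \<xi> \<in> {1..k1} \<Longrightarrow> \<phi>1 \<xi> differentiable_on D"
    and "\<And>\<tau>. \<tau> \<in> {1..k2} \<Longrightarrow> \<phi>2 \<tau> differentiable_on D"
    and "\<And>\<xi>. \<xi> \<in> {1..k1} \<Longrightarrow> T (u j \<xi>) differentiable_on D"
    and "\<And>\<tau>. \<tau> \<in> {1..k2} \<Longrightarrow> T (u j (CARD('n) + \<zeta> \<tau>)) differentiable_on D"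
    and "\<And>z. z \<in> D \<Longrightarrow> g z = coeff_dot \<zeta> k1 k2 u \<phi>1 \<phi>2 T j z"
  shows "g differentiable_on D"
proof -
  have "coeff_dot \<zeta> k1 k2 u \<phi>1 \<phi>2 T j differentiable_on D"
    using assms(1-4) unfolding coeff_dot_def[abs_def] differentiable_on_def
    by (auto intro!: differentiable_add differentiable_sum differentiable_mult)
  then show ?thesis using assms(5) by (rule differentiable_on_eq)
qed

section \<open>Partial integrals and integrating factors\<close>

text \<open>The derivatives that vanish on \<open>f\<close> vanish on every Wirtinger derivative of \<open>f\<close>, because they
  commute with it.  This makes the Wirtinger derivatives of \<open>f\<close> admissible as unknowns, which have
  to be cylindricality functions themselves.\<close>

lemma cylindrical_wirtinger:
  assumes "open D" and f: "twice_R_differentiable_on f D" and cyl: "cylindrical e \<zeta> k1 k2 D f"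
    and diff: "wirtinger c i f differentiable_on D"
  shows "cylindrical e \<zeta> k1 k2 D (wirtinger c i f)"
proof -
  have "wirtinger d k (wirtinger c i f) z = 0" if "z \<in> D" "\<And>x. x \<in> D \<Longrightarrow> wirtinger d k f x = 0" for d k z
    using wirtinger_commute[OF \<open>open D\<close> that(1) f, of d k c i]
      wirtinger_cong[OF \<open>open D\<close> that(1), of "wirtinger d k f" "\<lambda>_. 0" c i] that(2) by simp
  then show ?thesis
    using cyl diff unfolding cylindrical_def dz_eq_wirtinger dzbar_eq_wirtinger by blast
qed

text \<open>The differentiability of \<open>H\<^sub>j(f; z)\<close> and of its iterated derivatives is not given with the
  partial integral: it is inherited from the coefficients \<open>u\<close>, since on \<open>D\<close> these functions equal
  products of the unknowns with derivatives of \<open>u\<close>.\<close>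

lemma cylindrical_partial_integral_solves:
  fixes e :: "nat \<Rightarrow> 'n::finite"
  assumes "open D" and e: "bij_betw e {1..CARD('n)} UNIV" and \<zeta>: "\<zeta> permutes {1..CARD('n)}"
    and k: "k1 \<le> CARD('n)" "k2 \<le> CARD('n)"
    and u1: "\<And>j \<xi>. j \<in> {1..m} \<Longrightarrow> \<xi> \<in> {1..k1} \<Longrightarrow> system_derivs_exist e \<zeta> k1 k2 D (u j \<xi>)"
    and u2: "\<And>j \<tau>. j \<in> {1..m} \<Longrightarrow> \<tau> \<in> {1..k2} \<Longrightarrow>
               system_derivs_exist e \<zeta> k1 k2 D (u j (CARD('n) + \<zeta> \<tau>))"
    and f: "twice_R_differentiable_on f D" and cyl: "cylindrical e \<zeta> k1 k2 D f"
    and int: "partial_integral e m u D f"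
  defines "\<phi>1 \<equiv> \<lambda>\<xi>. dz (e \<xi>) f" and "\<phi>2 \<equiv> \<lambda>\<tau>. dzbar (e (\<zeta> \<tau>)) f"
  obtains H where "functional_system e \<zeta> k1 k2 m u D f \<phi>1 \<phi>2 H"
    and "integrates e \<zeta> k1 k2 D \<phi>1 \<phi>2 (\<lambda>z. 1) f"
proof -
  from int obtain H
    where "\<forall>j\<in>{1..m}. \<forall>z\<in>D. op_apply e u j f z = H j (f z) z \<and> H j 0 z = 0"
    unfolding partial_integral_def by (elim conjE exE)
  then have H: "\<And>j z. j \<in> {1..m} \<Longrightarrow> z \<in> D \<Longrightarrow> op_apply e u j f z = H j (f z) z \<and> H j 0 z = 0"
    by simp
  have c1: "cylindrical e \<zeta> k1 k2 D (\<phi>1 \<xi>)" and c2: "cylindrical e \<zeta> k1 k2 D (\<phi>2 \<tau>)" for \<xi> \<tau>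
    unfolding \<phi>1_def \<phi>2_def dz_eq_wirtinger dzbar_eq_wirtinger
    using f by (auto intro!: cylindrical_wirtinger[OF \<open>open D\<close> f cyl]
      simp: twice_R_differentiable_on_def dz_eq_wirtinger dzbar_eq_wirtinger)
  have c1': "\<phi>1 \<xi> differentiable_on D" and c2': "\<phi>2 \<tau> differentiable_on D" for \<xi> \<tau>
    using c1 c2 by (auto simp: cylindrical_def)
  have Hf: "H j (f z) z = coeff_dot \<zeta> k1 k2 u \<phi>1 \<phi>2 (\<lambda>g. g) j z" if "j \<in> {1..m}" "z \<in> D" for j z
    using H[OF that] op_apply_cylindrical[OF \<zeta> k cyl that(2)] by (simp add: \<phi>1_def \<phi>2_def)
  have power: "(T ^^ l) (\<lambda>z. H j (f z) z) z = coeff_dot \<zeta> k1 k2 u \<phi>1 \<phi>2 (T ^^ l) j z"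
    if T: "(\<exists>\<gamma>\<in>{k1<..CARD('n)}. T = dz (e \<gamma>)) \<or> (\<exists>\<delta>\<in>{k2<..CARD('n)}. T = dzbar (e (\<zeta> \<delta>)))"
      and j: "j \<in> {1..m}" and l: "l \<le> k1 + k2 - 1" and z: "z \<in> D" for T j l z
  proof -
    obtain c i where w: "T = wirtinger c i"
      using T by (auto simp: dz_eq_wirtinger dzbar_eq_wirtinger)
    show ?thesis
    proof (rule coeff_dot_wirtinger_power[OF \<open>open D\<close> w])
      show "\<phi>1 \<xi> differentiable_on D \<and> (\<forall>z\<in>D. T (\<phi>1 \<xi>) z = 0)"
        and "\<phi>2 \<xi> differentiable_on D \<and> (\<forall>z\<in>D. T (\<phi>2 \<xi>) z = 0)" for \<xi>
        using c1 c2 T by (auto simp: cylindrical_def)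
      show "(T ^^ l) (u j \<xi>) differentiable_on D" if "l < k1 + k2 - 1" "\<xi> \<in> {1..k1}" for l \<xi>
        using u1[OF j that(2)] that(1) T by (auto simp: system_derivs_exist_def)
      show "(T ^^ l) (u j (CARD('n) + \<zeta> \<tau>)) differentiable_on D" if "l < k1 + k2 - 1" "\<tau> \<in> {1..k2}" for l \<tau>
        using u2[OF j that(2)] that(1) T by (auto simp: system_derivs_exist_def)
    qed (use Hf j l z in auto)
  qed
  have derivs: "system_derivs_exist e \<zeta> k1 k2 D (\<lambda>z. H j (f z) z)" if j: "j \<in> {1..m}" for j
  proof -
    have "(\<lambda>z. H j (f z) z) differentiable_on D"
      by (rule coeff_dot_differentiable[OF c1' c2' _ _ Hf[OF j]])
        (use u1[OF j] u2[OF j] in \<open>auto simp: system_derivs_exist_def\<close>)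
    moreover have "(T ^^ l) (\<lambda>z. H j (f z) z) differentiable_on D"
      if T: "(\<exists>\<gamma>\<in>{k1<..CARD('n)}. T = dz (e \<gamma>)) \<or> (\<exists>\<delta>\<in>{k2<..CARD('n)}. T = dzbar (e (\<zeta> \<delta>)))"
        and l: "l < k1 + k2 - 1" for T l
    proof (rule coeff_dot_differentiable[OF c1' c2' _ _ power[OF T j less_imp_le[OF l]]])
      show "(T ^^ l) (u j \<xi>) differentiable_on D" if "\<xi> \<in> {1..k1}" for \<xi>
        using u1[OF j that] T l by (auto simp: system_derivs_exist_def)
      show "(T ^^ l) (u j (CARD('n) + \<zeta> \<tau>)) differentiable_on D" if "\<tau> \<in> {1..k2}" for \<tau>
        using u2[OF j that] T l by (auto simp: system_derivs_exist_def)
    qed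
    ultimately show ?thesis unfolding system_derivs_exist_def by blast
  qed
  show thesis
  proof (rule that[of H])
    show "functional_system e \<zeta> k1 k2 m u D f \<phi>1 \<phi>2 H"
      unfolding functional_system_def
    proof (intro conjI ballI)
      fix j l \<gamma> z assume "j \<in> {1..m}" "l \<in> {1..k1 + k2 - 1}" "\<gamma> \<in> {k1<..CARD('n)}" "z \<in> D"
      then show "coeff_dot \<zeta> k1 k2 u \<phi>1 \<phi>2 (dz (e \<gamma>) ^^ l) j z = (dz (e \<gamma>) ^^ l) (\<lambda>z. H j (f z) z) z"
        by (intro power[symmetric]) auto
    next
      fix j l \<delta> z assume "j \<in> {1..m}" "l \<in> {1..k1 + k2 - 1}" "\<delta> \<in> {k2<..CARD('n)}" "z \<in> D"
      then show "coeff_dot \<zeta> k1 k2 u \<phi>1 \<phi>2 (dzbar (e (\<zeta> \<delta>)) ^^ l) j z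
          = (dzbar (e (\<zeta> \<delta>)) ^^ l) (\<lambda>z. H j (f z) z) z"
        by (intro power[symmetric]) auto
    qed (use c1 c2 H Hf derivs in auto)
    have "cylindrical e \<zeta> k1 k2 D (\<lambda>z. 1)"
      by (simp add: cylindrical_def dz_eq_wirtinger dzbar_eq_wirtinger)
    then show "integrates e \<zeta> k1 k2 D \<phi>1 \<phi>2 (\<lambda>z. 1) f"
      using cylindrical_has_derivative_pfaff_form[OF e \<zeta> k cyl \<open>open D\<close>] cyl
      by (simp add: integrates_def \<phi>1_def \<phi>2_def)
  qed
qed

text \<open>The comparison of \<open>df\<close> with \<open>\<mu> \<omega>\<close> expresses the derivatives of \<open>f\<close> through products of
  differentiable functions, which supplies the second order of differentiability, and turns the
  undifferentiated equations of the functional system, multiplied by \<open>\<mu>\<close>, into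
  \<open>\<AA>\<^sub>j f = \<mu> H\<^sub>j(f; z)\<close>.\<close>

lemma integrates_partial_integral:
  fixes e :: "nat \<Rightarrow> 'n::finite"
  assumes "open D" and e: "bij_betw e {1..CARD('n)} UNIV" and \<zeta>: "\<zeta> permutes {1..CARD('n)}"
    and k: "k1 \<le> CARD('n)" "k2 \<le> CARD('n)"
    and sys: "functional_system e \<zeta> k1 k2 m u D f \<phi>1 \<phi>2 H"
    and int: "integrates e \<zeta> k1 k2 D \<phi>1 \<phi>2 \<mu> f" and nc: "\<not> f constant_on D"
  shows "twice_R_differentiable_on f D" and "partial_integral e m u D f"
proof -
  have cyl: "cylindrical e \<zeta> k1 k2 D f" and \<mu>: "\<mu> differentiable_on D"
    and f': "\<And>z. z \<in> D \<Longrightarrow> (f has_derivative (\<lambda>v. \<mu> z * pfaff_form e \<zeta> k1 k2 \<phi>1 \<phi>2 z v)) (at z)"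
    using int by (auto simp: integrates_def cylindrical_def)
  have fd: "f differentiable_on D" using cyl by (simp add: cylindrical_def)
  note w = wirtinger_of_pfaff_form[OF f']
  have \<phi>1: "\<phi>1 \<xi> differentiable_on D" if "\<xi> \<in> {1..k1}" for \<xi>
    using sys that by (simp add: functional_system_def cylindrical_def)
  have \<phi>2: "\<phi>2 \<tau> differentiable_on D" if "\<tau> \<in> {1..k2}" for \<tau>
    using sys that by (simp add: functional_system_def cylindrical_def)
  have "dz i f differentiable_on D" for i
  proof -
    have "(\<lambda>z. if e \<xi> = i then \<phi>1 \<xi> z else 0) differentiable_on D" if "\<xi> \<in> {1..k1}" for \<xi>
      using \<phi>1[OF that] by (cases "e \<xi> = i") auto
    then have "(\<lambda>z. \<mu> z * (\<Sum>\<xi>=1..k1. if e \<xi> = i then \<phi>1 \<xi> z else 0)) differentiable_on D"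
      using \<mu> unfolding differentiable_on_def
      by (intro ballI differentiable_mult differentiable_sum) auto
    then show ?thesis using w(1) by (rule differentiable_on_eq)
  qed
  moreover have "dzbar i f differentiable_on D" for i
  proof -
    have "(\<lambda>z. if e (\<zeta> \<tau>) = i then \<phi>2 \<tau> z else 0) differentiable_on D" if "\<tau> \<in> {1..k2}" for \<tau>
      using \<phi>2[OF that] by (cases "e (\<zeta> \<tau>) = i") auto
    then have "(\<lambda>z. \<mu> z * (\<Sum>\<tau>=1..k2. if e (\<zeta> \<tau>) = i then \<phi>2 \<tau> z else 0)) differentiable_on D"
      using \<mu> unfolding differentiable_on_def
      by (intro ballI differentiable_mult differentiable_sum) auto
    then show ?thesis using w(2) by (rule differentiable_on_eq)
  qed
  ultimately show "twice_R_differentiable_on f D"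
    using fd by (simp add: twice_R_differentiable_on_def)
  have inj: "e p = e q \<longleftrightarrow> p = q" if "p \<in> {1..CARD('n)}" "q \<in> {1..CARD('n)}" for p q
    using bij_betw_imp_inj_on[OF e] that by (auto dest: inj_onD)
  have dz: "dz (e \<xi>) f z = \<mu> z * \<phi>1 \<xi> z" if "\<xi> \<in> {1..k1}" "z \<in> D" for \<xi> z
  proof -
    have "(\<Sum>\<xi>'=1..k1. if e \<xi>' = e \<xi> then \<phi>1 \<xi>' z else 0) = (\<Sum>\<xi>'=1..k1. if \<xi>' = \<xi> then \<phi>1 \<xi>' z else 0)"
      by (rule sum.cong) (use that k in \<open>auto simp: inj\<close>)
    then show ?thesis using w(1)[OF that(2)] that(1) by simp
  qed
  have dzbar: "dzbar (e (\<zeta> \<tau>)) f z = \<mu> z * \<phi>2 \<tau> z" if "\<tau> \<in> {1..k2}" "z \<in> D" for \<tau> z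
  proof -
    have "e (\<zeta> \<tau>') = e (\<zeta> \<tau>) \<longleftrightarrow> \<tau>' = \<tau>" if "\<tau>' \<in> {1..k2}" for \<tau>'
      using inj[of "\<zeta> \<tau>'" "\<zeta> \<tau>"] permutes_in_image[OF \<zeta>] that \<open>\<tau> \<in> {1..k2}\<close> k permutes_inj[OF \<zeta>]
      by (auto dest: injD)
    then have "(\<Sum>\<tau>'=1..k2. if e (\<zeta> \<tau>') = e (\<zeta> \<tau>) then \<phi>2 \<tau>' z else 0)
        = (\<Sum>\<tau>'=1..k2. if \<tau>' = \<tau> then \<phi>2 \<tau>' z else 0)"
      by (intro sum.cong) auto
    then show ?thesis using w(2)[OF that(2)] that(1) by simp
  qed
  have "op_apply e u j f z = \<mu> z * H j (f z) z" if "j \<in> {1..m}" "z \<in> D" for j z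
  proof -
    have "op_apply e u j f z = \<mu> z * coeff_dot \<zeta> k1 k2 u \<phi>1 \<phi>2 (\<lambda>g. g) j z"
      unfolding op_apply_cylindrical[OF \<zeta> k cyl that(2)] coeff_dot_def distrib_left sum_distrib_left
      by (intro arg_cong2[of _ _ _ _ "(+)"] sum.cong) (use that dz dzbar in \<open>auto simp: mult.assoc\<close>)
    then show ?thesis using sys that by (simp add: functional_system_def)
  qed
  moreover have "\<mu> z * H j 0 z = 0" if "j \<in> {1..m}" "z \<in> D" for j z
    using sys that by (simp add: functional_system_def)
  ultimately show "partial_integral e m u D f"
    unfolding partial_integral_def using fd nc
    by (intro conjI exI[of _ "\<lambda>j w z. \<mu> z * H j w z"]) auto
qed

theorem theorem2p2:
  fixes G G' :: "(complex^'n::finite) set"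
    and e :: "nat \<Rightarrow> 'n" and \<zeta> :: "nat \<Rightarrow> nat" and k1 k2 m :: nat
    and u :: "nat \<Rightarrow> nat \<Rightarrow> complex^'n \<Rightarrow> complex"
  assumes "domain_in G" and "domain_in G'" and "G' \<subseteq> G"
    and "bij_betw e {1..CARD('n)} UNIV"
    and "\<zeta> permutes {1..CARD('n)}"
    and "k1 \<le> CARD('n)" and "k2 \<le> CARD('n)"
    and "\<And>j p. j \<in> {1..m} \<Longrightarrow> p \<in> {1..2 * CARD('n)} \<Longrightarrow> u j p differentiable_on G"
    and "\<And>j \<xi>. j \<in> {1..m} \<Longrightarrow> \<xi> \<in> {1..k1} \<Longrightarrow>
           system_derivs_exist e \<zeta> k1 k2 G' (u j \<xi>)"
    and "\<And>j \<tau>. j \<in> {1..m} \<Longrightarrow> \<tau> \<in> {1..k2} \<Longrightarrow>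
           system_derivs_exist e \<zeta> k1 k2 G' (u j (CARD('n) + \<zeta> \<tau>))"
    and "\<not> linearly_bound m u G"
  shows "let L = (\<lambda>f. twice_R_differentiable_on f G' \<and> cylindrical e \<zeta> k1 k2 G' f \<and>
                      partial_integral e m u G' f);
             R = (\<lambda>f. \<exists>\<phi>1 \<phi>2 H.
                      functional_system e \<zeta> k1 k2 m u G' f \<phi>1 \<phi>2 H \<and>
                      (\<exists>\<mu>. integrating_factor e \<zeta> k1 k2 G' \<phi>1 \<phi>2 \<mu>) \<and>
                      general_integral e \<zeta> k1 k2 G' \<phi>1 \<phi>2 f)
         in ((\<exists>f. L f) \<longleftrightarrow> (\<exists>f. R f)) \<and> (\<forall>f. L f \<longleftrightarrow> R f)"
proof -
  have D: "open G'" using assms(2) by (simp add: domain_in_def)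
  define L where "L = (\<lambda>f. twice_R_differentiable_on f G' \<and> cylindrical e \<zeta> k1 k2 G' f \<and>
                      partial_integral e m u G' f)"
  define R where "R = (\<lambda>f. \<exists>\<phi>1 \<phi>2 H.
                      functional_system e \<zeta> k1 k2 m u G' f \<phi>1 \<phi>2 H \<and>
                      (\<exists>\<mu>. integrating_factor e \<zeta> k1 k2 G' \<phi>1 \<phi>2 \<mu>) \<and>
                      general_integral e \<zeta> k1 k2 G' \<phi>1 \<phi>2 f)"
  have "L f \<longleftrightarrow> R f" for f
  proof
    assume "L f"
    then have f: "twice_R_differentiable_on f G'" "cylindrical e \<zeta> k1 k2 G' f"
      "partial_integral e m u G' f" by (auto simp: L_def)
    show "R f"
      using cylindrical_partial_integral_solves[OF D assms(4-7,9,10) f] f(3)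
      unfolding R_def integrating_factor_def general_integral_def partial_integral_def by metis
  next
    assume "R f"
    then obtain \<phi>1 \<phi>2 H \<mu> where
      "functional_system e \<zeta> k1 k2 m u G' f \<phi>1 \<phi>2 H" "integrates e \<zeta> k1 k2 G' \<phi>1 \<phi>2 \<mu> f"
      "\<not> f constant_on G'" unfolding R_def general_integral_def by blast
    note sol = this
    show "L f"
      using integrates_partial_integral[OF D assms(4-7) sol] sol(2)
      by (simp add: L_def integrates_def)
  qed
  then show ?thesis unfolding L_def[symmetric] R_def[symmetric] Let_def by blast
qed

end
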